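(* The tropical addition of complex numbers is associative: $(a\smile b)\smile c=a\smile(b\smile c)$ for any $a,b,c\in\mathbb{C}$.
   Context: Tropical addition on $\mathbb{C}$ is the multivalued operation $\smile$ defined by: if $|a|>|b|$, then $a\smile b=\{a\}$; if $|a|<|b|$, then $a\smile b=\{b\}$; if $|a|=|b|$ and $a+b\ne0$, then $a\smile b$ is the set of all complex numbers on the (closed) shortest arc connecting $a$ with $b$ on the circle $\{z\mid|z|=|a|\}$, i.e. if $a=re^{\alpha i}$, $b=re^{\beta i}$ with $|\beta-\alpha|<\pi$, then $a\smile b=\{re^{\varphi i}\mid|\alpha-\varphi|+|\varphi-\beta|=|\alpha-\beta|\}$; if $a+b=0$, then $a\smile b$ is the closed disk $\{c\in\mathbb{C}\mid|c|\le|a|\}$. The operation is extended to subsets by $A\smile B=\bigcup_{a\in A,b\in B}a\smile b$, and an element is identified with the one-element set containing it. *)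

theory Defs
  imports Complex_Main
begin

(* The closed shortest arc from a to b, for norm a = norm b and a + b \<noteq> 0. Lifts
   alpha, beta of the arguments with distance below pi are unique up to a common
   multiple of 2 * pi, so the set collected over all of them is a single arc. *)
definition shortest_arc :: "complex \<Rightarrow> complex \<Rightarrow> complex set" where
  "shortest_arc a b =
     {z. \<exists>\<alpha> \<beta> \<phi>. a = of_real (cmod a) * exp (\<i> * of_real \<alpha>)
               \<and> b = of_real (cmod a) * exp (\<i> * of_real \<beta>)
               \<and> \<bar>\<beta> - \<alpha>\<bar> < pi
               \<and> \<bar>\<alpha> - \<phi>\<bar> + \<bar>\<phi> - \<beta>\<bar> = \<bar>\<alpha> - \<beta>\<bar>
               \<and> z = of_real (cmod a) * exp (\<i> * of_real \<phi>)}"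

definition trop_add :: "complex \<Rightarrow> complex \<Rightarrow> complex set"  (infixl \<open>\<smile>\<close> 65) where
  "a \<smile> b =
     (if cmod a > cmod b then {a}
      else if cmod a < cmod b then {b}
      else if a + b \<noteq> 0 then shortest_arc a b
      else {c. cmod c \<le> cmod a})"

definition trop_add_set :: "complex set \<Rightarrow> complex set \<Rightarrow> complex set"  (infixl \<open>\<smile>\<^sub>S\<close> 65) where
  "A \<smile>\<^sub>S B = (\<Union>a\<in>A. \<Union>b\<in>B. a \<smile> b)"

end

(* For summands of equal modulus r, the sum a + b is the disk of radius r if 0 lies in the convex
   hull of a and b, and otherwise the part of the circle of radius r inside the convex cone that
   they span.  The same description, with hull and cone of three points, holds for (a + b) + c: if
   the hull of a, b, c contains 0, then -c lies in a + b and so the disk (-c) + c occurs.  This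
   description is invariant under cyclic permutations.  If the moduli differ, a summand of
   non-maximal modulus can be dropped.  With commutativity, associativity follows. *)
theory Submission
  imports Defs
begin

section \<open>Shortest arcs as cones\<close>

text \<open>Cramer's rule in the plane: each sine is the determinant of two of the three unit
  vectors. It supplies the coefficients that place \<open>cis \<phi>\<close> in the cone of the
  other two.\<close>

lemma sin_diff_cis:
  "complex_of_real (sin (\<beta> - \<alpha>)) * cis \<phi> =
     of_real (sin (\<beta> - \<phi>)) * cis \<alpha> + of_real (sin (\<phi> - \<alpha>)) * cis \<beta>"
proof -
  \<comment> \<open>With sines and cosines as free reals, the two coordinates are polynomial
    identities; the relation sin^2 + cos^2 = 1 does not enter.\<close>
  have 1: "(sb*ca - cb*sa)*cp = (sb*cp-cb*sp)*ca + (sp*ca-cp*sa)*cb" for sb ca cb sa cp sp :: real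
    by algebra
  have 2: "(sb*ca - cb*sa)*sp = (sb*cp-cb*sp)*sa + (sp*ca-cp*sa)*sb" for sb ca cb sa cp sp :: real
    by algebra
  show ?thesis
    by (simp add: complex_eq_iff sin_diff 1 2)
qed

lemma shortest_arc_def_cis:
  "shortest_arc a b =
     {z. \<exists>\<alpha> \<beta> \<phi>. a = of_real (cmod a) * cis \<alpha> \<and> b = of_real (cmod a) * cis \<beta>
       \<and> \<bar>\<beta> - \<alpha>\<bar> < pi \<and> \<bar>\<alpha> - \<phi>\<bar> + \<bar>\<phi> - \<beta>\<bar> = \<bar>\<alpha> - \<beta>\<bar>
       \<and> z = of_real (cmod a) * cis \<phi>}"
  by (simp add: shortest_arc_def cis_conv_exp)

lemma shortest_arc_commute:
  assumes "cmod a = cmod b"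
  shows "shortest_arc a b = shortest_arc b a"
proof -
  have "shortest_arc x y \<subseteq> shortest_arc y x" if "cmod x = cmod y" for x y
  proof
    fix z assume "z \<in> shortest_arc x y"
    then obtain \<alpha> \<beta> \<phi> where "x = of_real (cmod x) * cis \<alpha>" "y = of_real (cmod x) * cis \<beta>"
      "\<bar>\<beta> - \<alpha>\<bar> < pi" "\<bar>\<alpha> - \<phi>\<bar> + \<bar>\<phi> - \<beta>\<bar> = \<bar>\<alpha> - \<beta>\<bar>" "z = of_real (cmod x) * cis \<phi>"
      unfolding shortest_arc_def_cis by blast
    moreover from this have "\<bar>\<alpha> - \<beta>\<bar> < pi" "\<bar>\<beta> - \<phi>\<bar> + \<bar>\<phi> - \<alpha>\<bar> = \<bar>\<beta> - \<alpha>\<bar>"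
      by linarith+
    ultimately show "z \<in> shortest_arc y x"
      unfolding shortest_arc_def_cis mem_Collect_eq that[symmetric] by blast
  qed
  from this[of a b] this[of b a] assms show ?thesis by simp
qed

text \<open>Trading angles for cones removes the choice of lifts of the arguments, and nested cones,
  unlike arcs, compose by multiplying coefficients.\<close>

definition cone2 :: "complex \<Rightarrow> complex \<Rightarrow> complex set" where
  "cone2 a b = {of_real s * a + of_real t * b |s t. 0 \<le> s \<and> 0 \<le> t}"

lemma cone2I: "0 \<le> s \<Longrightarrow> 0 \<le> t \<Longrightarrow> of_real s * a + of_real t * b \<in> cone2 a b"
  unfolding cone2_def by blast

lemma cone2_commute: "cone2 a b = cone2 b a"
  unfolding cone2_def by (metis add.commute)

lemma cis_mem_cone2:
  assumes "\<bar>\<beta> - \<alpha>\<bar> < pi" and "\<bar>\<alpha> - \<phi>\<bar> + \<bar>\<phi> - \<beta>\<bar> = \<bar>\<alpha> - \<beta>\<bar>"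
  shows "cis \<phi> \<in> cone2 (cis \<alpha>) (cis \<beta>)"
proof -
  \<comment> \<open>The equation of absolute values says that \<phi> lies between \<alpha> and
    \<beta>, so up to a swap the order is as here. The case \<alpha> = \<beta> is separate because
    the next step divides by sin (\<beta> - \<alpha>).\<close>
  have *: "cis \<phi> \<in> cone2 (cis \<alpha>) (cis \<beta>)"
    if "\<alpha> \<le> \<phi>" "\<phi> \<le> \<beta>" "\<beta> - \<alpha> < pi" for \<alpha> \<beta>
  proof (cases "\<alpha> = \<beta>")
    case True
    with that have "cis \<phi> = of_real 1 * cis \<alpha> + of_real 0 * cis \<beta>" by simp
    then show ?thesis by (metis cone2I zero_le_one order_refl)
  next
    case False
    with that have pos: "sin (\<beta> - \<alpha>) > 0" by (intro sin_gt_zero) auto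
    have "sin (\<beta> - \<phi>) \<ge> 0" "sin (\<phi> - \<alpha>) \<ge> 0" using that by (auto intro!: sin_ge_zero)
    moreover have "cis \<phi> = of_real (sin (\<beta> - \<phi>) / sin (\<beta> - \<alpha>)) * cis \<alpha>
        + of_real (sin (\<phi> - \<alpha>) / sin (\<beta> - \<alpha>)) * cis \<beta>"
      using sin_diff_cis[of \<beta> \<alpha> \<phi>] pos by (simp add: field_simps)
    ultimately show ?thesis using pos by (metis cone2I divide_nonneg_pos)
  qed
  show ?thesis
  proof (cases "\<alpha> \<le> \<beta>")
    case True
    with assms show ?thesis by (intro *) linarith+
  next
    case False
    with assms have "cis \<phi> \<in> cone2 (cis \<beta>) (cis \<alpha>)" by (intro *) linarith+
    then show ?thesis by (simp add: cone2_commute)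
  qed
qed

lemma cone2_scale:
  assumes "z \<in> cone2 a b"
  shows "w * z \<in> cone2 (w * a) (w * b)"
  using assms unfolding cone2_def by (force simp: algebra_simps)

lemma shortest_arc_subset_cone2:
  assumes "z \<in> shortest_arc a b"
  shows "cmod z = cmod a \<and> z \<in> cone2 a b"
proof -
  obtain \<alpha> \<beta> \<phi> where a: "a = of_real (cmod a) * cis \<alpha>" and b: "b = of_real (cmod a) * cis \<beta>"
    and "\<bar>\<beta> - \<alpha>\<bar> < pi" "\<bar>\<alpha> - \<phi>\<bar> + \<bar>\<phi> - \<beta>\<bar> = \<bar>\<alpha> - \<beta>\<bar>"
    and z: "z = of_real (cmod a) * cis \<phi>"
    using assms unfolding shortest_arc_def_cis by blast
  then have "z \<in> cone2 (of_real (cmod a) * cis \<alpha>) (of_real (cmod a) * cis \<beta>)"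
    by (metis cone2_scale cis_mem_cone2)
  moreover have "cmod z = cmod a"
    by (subst z) (simp add: norm_mult)
  ultimately show ?thesis by (simp flip: a b)
qed

lemma cis_Arg_unit: "cmod z = 1 \<Longrightarrow> cis (Arg z) = z"
  by (metis cis_Arg div_by_1 norm_zero of_real_1 sgn_eq zero_neq_one)

text \<open>If Arg w exceeded Arg d by less than pi, then \<open>w * cnj d\<close>, which is w / d
  for a unit d, would have positive imaginary part. But for w = s + t d it equals
  \<open>s * cnj d + t\<close>, with imaginary part - s Im d \<le> 0.\<close>

lemma Arg_between_of_cone2:
  assumes d: "cmod d = 1" "d \<noteq> -1" "0 \<le> Im d" and w: "cmod w = 1" "w \<in> cone2 1 d"
  shows "0 \<le> Arg w" "Arg w \<le> Arg d"
proof -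
  obtain s t where st: "0 \<le> s" "0 \<le> t" "w = of_real s + of_real t * d"
    using w(2) unfolding cone2_def by auto
  have cd: "cis (Arg d) = d" and cw: "cis (Arg w) = w"
    using d(1) w(1) by (simp_all add: cis_Arg_unit)
  have imd: "sin (Arg d) = Im d" and imw: "sin (Arg w) = Im w"
    using cd cw by (metis cis.sel(2))+
  have "0 \<le> Im w" using st d(3) by simp
  have "0 \<le> Arg v" if "cis (Arg v) = v" "0 \<le> Im v" for v
  proof (rule ccontr)
    assume "\<not> 0 \<le> Arg v"
    then have "sin (Arg v) < 0"
      using sin_gt_zero[of "- Arg v"] Arg_bounded[of v] by auto
    with that show False by (metis cis.sel(2) not_less)
  qed
  with cd cw d(3) \<open>0 \<le> Im w\<close> have nn: "0 \<le> Arg d" "0 \<le> Arg w" by blast+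
  then show "0 \<le> Arg w" by blast
  have "Arg d \<noteq> pi" using cd d(2) by (metis cis_pi)
  then have dlt: "Arg d < pi" using Arg_bounded[of d] by linarith
  show "Arg w \<le> Arg d"
  proof (rule ccontr)
    assume less: "\<not> Arg w \<le> Arg d"
    have "cis (Arg w - Arg d) = w * cnj d"
      using cis_mult[of "Arg w" "- Arg d"] by (simp add: cd cw flip: cis_cnj)
    also have "\<dots> = of_real s * cnj d + of_real t"
      using d(1) by (simp add: st(3) algebra_simps complex_norm_square[symmetric])
    finally have eq: "cis (Arg w - Arg d) = of_real s * cnj d + of_real t" .
    from arg_cong[OF this, of Im] have "sin (Arg w - Arg d) = - (s * Im d)"
      by simp
    then have "sin (Arg w - Arg d) \<le> 0" using st(1) d(3) by simp
    moreover have "Arg w - Arg d > 0" "Arg w - Arg d \<le> pi"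
      using less nn Arg_bounded[of w] by linarith+
    ultimately have "Arg w - Arg d = pi" using sin_gt_zero[of "Arg w - Arg d"] by linarith
    \<comment> \<open>Both arguments lie in [0, pi], so a difference of pi forces the two ends; then
      w = -1 would be the nonnegative real s + t.\<close>
    then have "Arg w = pi" "Arg d = 0" using nn Arg_bounded[of w] by linarith+
    with cd cw have "d = 1" "w = -1" by (metis cis_zero, metis cis_pi)
    with st show False by (simp add: complex_eq_iff)
  qed
qed

text \<open>Division by a moves a to 1 and reduces to \<open>Arg_between_of_cone2\<close>. That b /
  a lies in the closed upper half-plane is arranged by swapping a and b if necessary.\<close>

lemma cone2_subset_shortest_arc:
  assumes ab: "cmod a = cmod b" "a + b \<noteq> 0" and z: "cmod z = cmod a" "z \<in> cone2 a b"
  shows "z \<in> shortest_arc a b"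
proof -
  have *: "z \<in> shortest_arc a b"
    if ab: "cmod a = cmod b" "a + b \<noteq> 0" and z: "cmod z = cmod a" "z \<in> cone2 a b"
      and im: "0 \<le> Im (b / a)" for a b
  proof -
    have nz: "a \<noteq> 0" "b \<noteq> 0" using ab by auto
    have ne: "b / a \<noteq> -1" using ab nz by (auto simp: field_simps)
    have nd: "cmod (b / a) = 1" and nw: "cmod (z / a) = 1" using ab(1) z(1) nz by (simp_all add: norm_divide)
    have "z / a \<in> cone2 1 (b / a)" using cone2_scale[OF z(2), of "1 / a"] nz by simp
    note bds = Arg_between_of_cone2[OF nd ne im nw this]
    have "Arg (b / a) \<noteq> pi"
      using ne cis_Arg_unit[OF nd] by (metis cis_pi)
    then have lt: "Arg (b / a) < pi" using Arg_bounded[of "b / a"] by linarith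
    have a: "a = of_real (cmod a) * cis (Arg a)" using rcis_cmod_Arg[of a] by (simp add: rcis_def)
    \<comment> \<open>The lift Arg a + Arg (x / a), unlike Arg x, has distance exactly Arg (x / a)
      from Arg a, with no jump by 2 pi.\<close>
    have mult: "x = of_real (cmod a) * cis (Arg a + Arg (x / a))" if "cmod x = cmod a" for x
    proof -
      have "cis (Arg (x / a)) = x / a"
        using that nz by (simp add: cis_Arg_unit norm_divide)
      then have "of_real (cmod a) * cis (Arg a + Arg (x / a)) = a * (x / a)"
        using a by (metis cis_mult mult.assoc)
      then show ?thesis using nz by simp
    qed
    show ?thesis
      unfolding shortest_arc_def_cis mem_Collect_eq
      using a mult[of b] mult[of z] ab z bds lt
      by (intro exI[of _ "Arg a"] exI[of _ "Arg a + Arg (b / a)"] exI[of _ "Arg a + Arg (z / a)"]) auto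
  qed
  show ?thesis
  proof (cases "0 \<le> Im (b / a)")
    case True
    with assms show ?thesis by (intro *)
  next
    case False
    then have "0 \<le> Im (a / b)"
      by (auto simp: Im_divide zero_le_divide_iff not_le divide_less_0_iff algebra_simps)
    with assms have "z \<in> shortest_arc b a" by (intro *) (auto simp: cone2_commute add.commute)
    then show ?thesis using shortest_arc_commute[OF ab(1)] by simp
  qed
qed

lemma shortest_arc_eq_cone2:
  assumes "cmod a = cmod b" "a + b \<noteq> 0"
  shows "shortest_arc a b = {z \<in> cone2 a b. cmod z = cmod a}"
  using shortest_arc_subset_cone2 cone2_subset_shortest_arc[OF assms] by blast

section \<open>Tropical sums\<close>

lemma trop_add_commute: "a \<smile> b = b \<smile> a"
  unfolding trop_add_def using shortest_arc_commute[of a b] by (auto simp: add.commute)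

lemma trop_add_left: "cmod b < cmod a \<Longrightarrow> a \<smile> b = {a}"
  by (simp add: trop_add_def)

lemma trop_add_right: "cmod a < cmod b \<Longrightarrow> a \<smile> b = {b}"
  by (simp add: trop_add_def)

lemma trop_add_arc:
  "cmod a = cmod b \<Longrightarrow> a + b \<noteq> 0 \<Longrightarrow> a \<smile> b = {z \<in> cone2 a b. cmod z = cmod a}"
  by (simp add: trop_add_def shortest_arc_eq_cone2)

lemma trop_add_disk: "a + b = 0 \<Longrightarrow> a \<smile> b = {z. cmod z \<le> cmod a}"
  by (auto simp: trop_add_def add_eq_0_iff)

lemma norm_trop_add_le: "z \<in> a \<smile> b \<Longrightarrow> cmod z \<le> max (cmod a) (cmod b)"
  using shortest_arc_subset_cone2[of z a b] by (auto simp: trop_add_def split: if_splits)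

lemma norm_trop_add_eq: "a + b \<noteq> 0 \<Longrightarrow> z \<in> a \<smile> b \<Longrightarrow> cmod z = max (cmod a) (cmod b)"
  using shortest_arc_subset_cone2[of z a b] by (auto simp: trop_add_def split: if_splits)

lemma trop_add_set_right: "A \<smile>\<^sub>S {c} = (\<Union>z\<in>A. z \<smile> c)"
  by (simp add: trop_add_set_def)

lemma trop_add_set_left: "{c} \<smile>\<^sub>S A = (\<Union>z\<in>A. z \<smile> c)"
  by (simp add: trop_add_set_def trop_add_commute)

text \<open>If a + b is nonzero, all elements of a \<smile> b have maximal modulus and absorb c.
  Otherwise a \<smile> b is a disk: its points outside the radius of c absorb c, and the smaller
  disk is recovered as (-c) \<smile> c.\<close>

lemma trop_add_drop_third:
  assumes "cmod c < max (cmod a) (cmod b)"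
  shows "(a \<smile> b) \<smile>\<^sub>S {c} = a \<smile> b"
proof (cases "a + b = 0")
  case False
  with assms have "z \<smile> c = {z}" if "z \<in> a \<smile> b" for z
    using norm_trop_add_eq[OF False that] by (simp add: trop_add_left)
  then show ?thesis by (simp add: trop_add_set_right)
next
  case True
  then have "cmod a = cmod b" by (metis add_eq_0_iff norm_minus_cancel)
  with assms have lt: "cmod c < cmod a" by simp
  have "(\<Union>z\<in>{z. cmod z \<le> cmod a}. z \<smile> c) = {z. cmod z \<le> cmod a}"
  proof (intro equalityI subsetI)
    fix w assume "w \<in> (\<Union>z\<in>{z. cmod z \<le> cmod a}. z \<smile> c)"
    with lt show "w \<in> {z. cmod z \<le> cmod a}" using norm_trop_add_le[of w _ c] by fastforce
  next
    fix w assume w: "w \<in> {z. cmod z \<le> cmod a}"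
    show "w \<in> (\<Union>z\<in>{z. cmod z \<le> cmod a}. z \<smile> c)"
    proof (cases "cmod w \<le> cmod c")
      case True
      then have "w \<in> - c \<smile> c" by (simp add: trop_add_disk)
      with lt show ?thesis by (intro UN_I[of "- c"]) auto
    next
      case False
      then have "w \<in> w \<smile> c" by (simp add: trop_add_left)
      with w show ?thesis by blast
    qed
  qed
  with True show ?thesis by (simp add: trop_add_set_right trop_add_disk)
qed

text \<open>Either b absorbs a at once, or c is larger than both a and b and absorbs everything in a
  \<smile> b.\<close>

lemma trop_add_drop_first:
  assumes "cmod a < max (cmod b) (cmod c)"
  shows "(a \<smile> b) \<smile>\<^sub>S {c} = b \<smile> c"
proof (cases "cmod a < cmod b")
  case True
  then show ?thesis by (simp add: trop_add_set_right trop_add_right)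
next
  case False
  with assms have lt: "cmod a < cmod c" "cmod b < cmod c" by auto
  have "z \<smile> c = {c}" if "z \<in> a \<smile> b" for z
    using norm_trop_add_le[OF that] lt by (intro trop_add_right) auto
  \<comment> \<open>Without this the union over a \<smile> b could be empty instead of {c}.\<close>
  moreover have "a \<smile> b \<noteq> {}"
  proof (cases "cmod a = cmod b \<and> a + b \<noteq> 0")
    case True
    have "a \<in> cone2 a b" using cone2I[of 1 0 a b] by simp
    with True show ?thesis by (auto simp: trop_add_arc)
  next
    case False
    then show ?thesis by (auto simp: trop_add_def intro: exI[of _ a])
  qed
  ultimately show ?thesis using lt by (simp add: trop_add_set_right trop_add_right)
qed

lemma trop_add_drop_second:
  assumes "cmod b < max (cmod a) (cmod c)"
  shows "(a \<smile> b) \<smile>\<^sub>S {c} = a \<smile> c"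
  using trop_add_drop_first[OF assms] by (simp add: trop_add_commute)

section \<open>Three summands of equal modulus\<close>

definition cone3 :: "complex \<Rightarrow> complex \<Rightarrow> complex \<Rightarrow> complex set" where
  "cone3 a b c = {of_real s * a + of_real t * b + of_real u * c |s t u. 0 \<le> s \<and> 0 \<le> t \<and> 0 \<le> u}"

lemma cone3_rotate: "cone3 a b c = cone3 b c a"
proof -
  have "cone3 a b c \<subseteq> cone3 b c a" for a b c
    unfolding cone3_def by clarsimp (metis add.assoc add.commute)
  \<comment> \<open>Three rotations lead back to the start, so the chain of inclusions closes up to
    equalities.\<close>
  from this[of a b c] this[of b c a] this[of c a b] show ?thesis by blast
qed

text \<open>Weights of positive sum replace weights of sum 1; division by the sum gives the convex
  combination.\<close>

definition zero_in_hull3 :: "complex \<Rightarrow> complex \<Rightarrow> complex \<Rightarrow> bool" where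
  "zero_in_hull3 a b c \<longleftrightarrow>
     (\<exists>s t u. 0 \<le> s \<and> 0 \<le> t \<and> 0 \<le> u \<and> 0 < s + t + u
       \<and> of_real s * a + of_real t * b + of_real u * c = 0)"

lemma zero_in_hull3_rotate: "zero_in_hull3 a b c \<longleftrightarrow> zero_in_hull3 b c a"
proof -
  have "zero_in_hull3 b c a" if hull: "zero_in_hull3 a b c" for a b c
  proof -
    obtain s t u where stu: "0 \<le> s" "0 \<le> t" "0 \<le> u" "0 < s + t + u"
      "of_real s * a + of_real t * b + of_real u * c = 0"
      using hull unfolding zero_in_hull3_def by blast
    then have "0 < t + u + s" "of_real t * b + of_real u * c + of_real s * a = 0"
      by (simp_all add: ac_simps)
    with stu show ?thesis unfolding zero_in_hull3_def by blast
  qed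
  from this[of a b c] this[of b c a] this[of c a b] show ?thesis by blast
qed

lemma trop_add3_disk:
  assumes eq: "cmod a = cmod b" "cmod b = cmod c" and "zero_in_hull3 a b c"
  shows "(a \<smile> b) \<smile>\<^sub>S {c} = {z. cmod z \<le> cmod c}"
proof -
  obtain s t u where stu: "0 \<le> s" "0 \<le> t" "0 \<le> u" "0 < s + t + u"
    and zero: "of_real s * a + of_real t * b + of_real u * c = 0"
    using assms(3) unfolding zero_in_hull3_def by blast
  have "- c \<in> a \<smile> b"
  proof (cases "a + b = 0")
    case True
    with eq show ?thesis by (simp add: trop_add_disk)
  next
    case False
    \<comment> \<open>For u = 0 the relation reads s a = - t b. Equal moduli give s = t, hence a + b
      = 0, which is excluded here.\<close>
    have "u \<noteq> 0"
    proof
      assume u: "u = 0"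
      with zero have sa: "of_real s * a = - (of_real t * b)" by (simp add: add_eq_0_iff2)
      then have "cmod (of_real s * a) = cmod (of_real t * b)" by simp
      with eq stu have "s * cmod b = t * cmod b" by (simp add: norm_mult)
      moreover have "cmod b \<noteq> 0" using False eq(1) by auto
      ultimately have "s = t" by simp
      with stu u have "s \<noteq> 0" by auto
      from sa have "of_real s * (a + b) = 0" unfolding \<open>s = t\<close> by (simp add: algebra_simps)
      with \<open>s \<noteq> 0\<close> False show False by simp
    qed
    then have "- c = of_real (s / u) * a + of_real (t / u) * b"
      using zero by (simp add: field_simps) (simp add: algebra_simps eq_neg_iff_add_eq_0 neg_eq_iff_add_eq_0)
    then have "- c \<in> cone2 a b" using stu by (metis cone2I divide_nonneg_nonneg)
    with eq False show ?thesis by (simp add: trop_add_arc)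
  qed
  moreover have "w \<in> - c \<smile> c" if "cmod w \<le> cmod c" for w
    using that by (simp add: trop_add_disk)
  moreover have "cmod w \<le> cmod c" if "z \<in> a \<smile> b" "w \<in> z \<smile> c" for z w
    using norm_trop_add_le[OF that(1)] norm_trop_add_le[OF that(2)] eq by simp
  ultimately show ?thesis unfolding trop_add_set_right by blast
qed

text \<open>No disk can occur: an antipodal pair, be it a, b or z, c with z in a \<smile> b, would
  put 0 into the hull. So both sums are arcs, and their cones compose to
  \<open>cone3\<close>.\<close>

lemma trop_add3_cone:
  assumes eq: "cmod a = cmod b" "cmod b = cmod c" and nz: "\<not> zero_in_hull3 a b c"
  shows "(a \<smile> b) \<smile>\<^sub>S {c} = {z \<in> cone3 a b c. cmod z = cmod c}"
proof -
  have nz': "of_real s * a + of_real t * b + of_real u * c \<noteq> 0"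
    if "0 \<le> s" "0 \<le> t" "0 \<le> u" "0 < s + t + u" for s t u
    using nz that unfolding zero_in_hull3_def by blast
  have "a + b \<noteq> 0" using nz'[of 1 1 0] by simp
  with eq have arc: "a \<smile> b = {z \<in> cone2 a b. cmod z = cmod c}" by (simp add: trop_add_arc)
  \<comment> \<open>For z = s a + t b this is the combination with weights s, t, 1.\<close>
  have "z + c \<noteq> 0" if "z \<in> cone2 a b" for z
    using that nz'[of _ _ 1] unfolding cone2_def by force
  then have arc': "z \<smile> c = {w \<in> cone2 z c. cmod w = cmod c}" if "z \<in> a \<smile> b" for z
    using that arc by (auto simp: trop_add_arc)
  show ?thesis
  proof (intro equalityI subsetI)
    fix w assume "w \<in> (a \<smile> b) \<smile>\<^sub>S {c}"
    then obtain z where "z \<in> cone2 a b" "w \<in> cone2 z c" and w: "cmod w = cmod c"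
      using arc arc' by (auto simp: trop_add_set_right)
    then obtain s t p q where "0 \<le> s" "0 \<le> t" "0 \<le> p" "0 \<le> q"
      and "w = of_real p * (of_real s * a + of_real t * b) + of_real q * c"
      unfolding cone2_def by blast
    then have "0 \<le> p * s" "0 \<le> p * t" "0 \<le> q"
      "w = of_real (p * s) * a + of_real (p * t) * b + of_real q * c"
      by (auto simp: algebra_simps)
    then have "w \<in> cone3 a b c" unfolding cone3_def by blast
    with w show "w \<in> {z \<in> cone3 a b c. cmod z = cmod c}" by simp
  next
    fix w assume "w \<in> {z \<in> cone3 a b c. cmod z = cmod c}"
    then obtain s t u where stu: "0 \<le> s" "0 \<le> t" "0 \<le> u"
      and w: "w = of_real s * a + of_real t * b + of_real u * c" and nw: "cmod w = cmod c"
      unfolding cone3_def by blast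
    have "\<exists>z\<in>a \<smile> b. w \<in> cone2 z c"
    \<comment> \<open>If s = t = 0, then w is a multiple of c and any z in a \<smile> b serves, for
      instance a.\<close>
    proof (cases "s + t = 0")
      case True
      with stu have "s = 0" "t = 0" by auto
      then have "w \<in> cone2 a c" using cone2I[of 0 u a c] stu w by simp
      moreover have "a \<in> a \<smile> b" using cone2I[of 1 0 a b] eq arc by simp
      ultimately show ?thesis by blast
    next
      case False
      \<comment> \<open>The part of w spanned by a and b is nonzero, and the factor k brings it to
        the circle, where it is an element of a \<smile> b.\<close>
      define v where "v = of_real s * a + of_real t * b"
      have v: "v \<noteq> 0" using nz'[of s t 0] stu False unfolding v_def by simp
      have c: "c \<noteq> 0" using nz'[of 0 0 1] by simp
      define k where "k = cmod c / cmod v"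
      have k: "0 < k" using v c by (simp add: k_def)
      have "of_real k * v = of_real (k * s) * a + of_real (k * t) * b"
        by (simp add: v_def algebra_simps)
      then have "of_real k * v \<in> cone2 a b"
        using stu k by (metis cone2I mult_nonneg_nonneg less_imp_le)
      moreover have "cmod (of_real k * v) = cmod c" using v by (simp add: norm_mult norm_divide k_def)
      ultimately have "of_real k * v \<in> a \<smile> b" by (simp add: arc)
      moreover have "w \<in> cone2 (of_real k * v) c"
        using cone2I[of "1 / k" u "of_real k * v" c] k stu w by (simp add: v_def)
      ultimately show ?thesis by blast
    qed
    then show "w \<in> (a \<smile> b) \<smile>\<^sub>S {c}" using arc' nw by (auto simp: trop_add_set_right)
  qed
qed

lemma trop_add3_rotate: "(a \<smile> b) \<smile>\<^sub>S {c} = (b \<smile> c) \<smile>\<^sub>S {a}"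
proof -
  \<comment> \<open>If no modulus is below the maximum of the other two, all three agree. In each of
    the first three cases both sides reduce to the sum of the two remaining summands.\<close>
  consider "cmod a < max (cmod b) (cmod c)" | "cmod b < max (cmod a) (cmod c)"
    | "cmod c < max (cmod a) (cmod b)" | "cmod a = cmod b" "cmod b = cmod c"
    by linarith
  then show ?thesis
  proof cases
    case 1
    then show ?thesis by (simp add: trop_add_drop_first trop_add_drop_third)
  next
    case 2
    then show ?thesis
      using trop_add_drop_first[of b c a]
      by (simp add: trop_add_drop_second max.commute trop_add_commute)
  next
    case 3
    then show ?thesis
      using trop_add_drop_second[of c b a]
      by (simp add: trop_add_drop_third max.commute trop_add_commute)
  next
    case 4
    then have eq: "cmod b = cmod c" "cmod c = cmod a" by simp_all
    show ?thesis
    proof (cases "zero_in_hull3 a b c")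
      case True
      with 4 show ?thesis
        using trop_add3_disk[OF eq] by (simp add: trop_add3_disk zero_in_hull3_rotate[of a])
    next
      case False
      with 4 show ?thesis
        using trop_add3_cone[OF eq]
        by (simp add: trop_add3_cone zero_in_hull3_rotate[of a] cone3_rotate[of a])
    qed
  qed
qed

theorem theorem6:
  fixes a b c :: complex
  shows "(a \<smile> b) \<smile>\<^sub>S {c} = {a} \<smile>\<^sub>S (b \<smile> c)"
  \<comment> \<open>\<open>trop_add_set_left\<close> contains commutativity: it moves a behind b
    \<smile> c, which turns the rotation into associativity.\<close>
  using trop_add3_rotate[of a b c] by (simp only: trop_add_set_left trop_add_set_right)

end
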